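(* Let $(f_n)_{n\ge1}$ be a sequence of functions $f_n\colon\{0,1\}^n\to[0,1]$. For every $p\in(0,1)$, $$\lim_{n\to\infty} I\!I_p(f_n)=0\quad\Longrightarrow\quad (f_n)_{n\ge1}\text{ is noise sensitive at density }p\ (\mathrm{NS}_p).$$
   Context: $\mathbb{P}_p$ (expectation $\mathbb{E}_p$) is the product measure on $\{0,1\}^n$ with $\mathbb{P}_p(\omega_i=1)=p$ independently for each $i\in[n]=\{1,\dots,n\}$. Given $\omega$ with law $\mathbb{P}_p$ and $\varepsilon\in(0,1]$, $\omega^\varepsilon$ is obtained by re-sampling each coordinate of $\omega$ independently with probability $\varepsilon$ (a re-sampled coordinate is replaced by an independent Bernoulli($p$) value). A sequence $f_n\colon\{0,1\}^n\to[0,1]$ is noise sensitive at density $p$ ($\mathrm{NS}_p$) if for every $\varepsilon\in(0,1]$, $\lim_{n\to\infty}\big(\mathbb{E}_p[f_n(\omega)f_n(\omega^\varepsilon)]-\mathbb{E}_p[f_n(\omega)]^2\big)=0$. For $f\colon\{0,1\}^n\to[0,1]$ the influence of coordinate $i$ at density $p$ is $\mathrm{Inf}_{p,i}(f)=\mathbb{E}_p\big[|f(\omega)-f(\sigma_i\omega)|\big]$, where $\sigma_i$ flips the $i$-th coordinate of $\omega$, and $I\!I_p(f)=\sum_{i=1}^n\mathrm{Inf}_{p,i}(f)^2$. *)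

theory Defs
  imports "HOL-Probability.Probability"
begin

text \<open>
  A configuration in \<open>{0,1}\<^sup>n\<close> is a map \<^typ>\<open>nat \<Rightarrow> bool\<close>, with \<open>True\<close> standing for 1, that takes
  the default value \<open>False\<close> outside the coordinate set \<open>{1..n}\<close>.
\<close>

definition cube :: "nat \<Rightarrow> (nat \<Rightarrow> bool) set" where
  "cube n = PiE_dflt {1..n} False (\<lambda>_. UNIV)"

definition bernoulli_cube :: "nat \<Rightarrow> real \<Rightarrow> (nat \<Rightarrow> bool) pmf" where
  "bernoulli_cube n p = Pi_pmf {1..n} False (\<lambda>_. bernoulli_pmf p)"

text \<open>
  The joint law of \<open>(\<omega>, \<omega>\<^sup>\<epsilon>)\<close>: \<open>r\<close> is the random set of re-sampled coordinates and \<open>\<eta>\<close> supplies the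
  new values; \<open>\<omega>\<close>, \<open>r\<close> and \<open>\<eta>\<close> are independent.
\<close>

definition noise_pair :: "nat \<Rightarrow> real \<Rightarrow> real \<Rightarrow> ((nat \<Rightarrow> bool) \<times> (nat \<Rightarrow> bool)) pmf" where
  "noise_pair n p \<epsilon> = do {
     \<omega> \<leftarrow> bernoulli_cube n p;
     r \<leftarrow> bernoulli_cube n \<epsilon>;
     \<eta> \<leftarrow> bernoulli_cube n p;
     return_pmf (\<omega>, \<lambda>i. if r i then \<eta> i else \<omega> i)
   }"

definition noise_sensitive :: "real \<Rightarrow> (nat \<Rightarrow> (nat \<Rightarrow> bool) \<Rightarrow> real) \<Rightarrow> bool" where
  "noise_sensitive p f \<longleftrightarrow>
     (\<forall>\<epsilon>\<in>{0<..1}.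
        (\<lambda>n. measure_pmf.expectation (noise_pair n p \<epsilon>) (\<lambda>(\<omega>, \<omega>'). f n \<omega> * f n \<omega>')
             - (measure_pmf.expectation (bernoulli_cube n p) (f n))\<^sup>2) \<longlonglongrightarrow> 0)"

definition flip :: "nat \<Rightarrow> (nat \<Rightarrow> bool) \<Rightarrow> nat \<Rightarrow> bool" where
  "flip i \<omega> = fun_upd \<omega> i (\<not> \<omega> i)"

definition influence :: "nat \<Rightarrow> real \<Rightarrow> nat \<Rightarrow> ((nat \<Rightarrow> bool) \<Rightarrow> real) \<Rightarrow> real" where
  "influence n p i f = measure_pmf.expectation (bernoulli_cube n p) (\<lambda>\<omega>. \<bar>f \<omega> - f (flip i \<omega>)\<bar>)"

definition sum_sq_influences :: "nat \<Rightarrow> real \<Rightarrow> ((nat \<Rightarrow> bool) \<Rightarrow> real) \<Rightarrow> real" where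
  "sum_sq_influences n p f = (\<Sum>i=1..n. (influence n p i f)\<^sup>2)"

end

theory Submission
  imports Defs
begin

text \<open>
  Expand \<open>f\<close> in the \<open>p\<close>-biased Fourier basis \<open>chi S\<close> with coefficients \<open>c S\<close>; the noise covariance is
  the sum of \<open>(1 - \<epsilon>) ^ card S * (c S)\<^sup>2\<close> over \<open>S \<noteq> {}\<close>. Let \<open>T\<close> be the multiplier \<open>r ^ card S\<close> with \<open>r\<close>
  so small that \<open>T\<close> is a contraction from \<open>L\<^sup>2\<close> to \<open>L\<^sup>4\<close>, and \<open>u\<^sub>i = T (D\<^sub>i f)\<close>, where \<open>D\<^sub>i\<close> keeps the terms
  with \<open>i \<in> S\<close>. Hypercontractivity and two applications of Cauchy-Schwarz give
  \<open>\<parallel>T u\<^sub>i\<parallel>\<^sub>2\<^sup>2 \<le> \<parallel>u\<^sub>i\<parallel>\<^sub>2 \<parallel>u\<^sub>i\<parallel>\<^sub>1\<close>. Here \<open>\<parallel>u\<^sub>i\<parallel>\<^sub>1\<close> is at most the influence of \<open>i\<close>, because \<open>T\<close> contracts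
  \<open>L\<^sup>1\<close>, while the damping by \<open>T\<close> makes the sum of \<open>\<parallel>u\<^sub>i\<parallel>\<^sub>2\<^sup>2\<close> bounded although the total influence of \<open>f\<close>
  need not be. Summing over \<open>i\<close>, the square root of the sum of squared influences bounds the
  Fourier weight damped by \<open>r ^ (4 * card S)\<close>; high levels are killed by the noise itself.
\<close>

subsection \<open>Expectations over the cube\<close>

lemma cube_iff: "\<omega> \<in> cube n \<longleftrightarrow> (\<forall>i. i \<notin> {1..n} \<longrightarrow> \<not> \<omega> i)"
  by (auto simp: cube_def PiE_dflt_def)

lemma finite_cube [simp]: "finite (cube n)"
  unfolding cube_def by (rule finite_PiE_dflt) auto

lemma set_bernoulli_cube: "set_pmf (bernoulli_cube n p) \<subseteq> cube n"
  unfolding bernoulli_cube_def cube_def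
  by (rule order_trans[OF set_Pi_pmf_subset']) (auto simp: PiE_dflt_def)

lemma finite_set_bernoulli_cube [simp]: "finite (set_pmf (bernoulli_cube n p))"
  by (rule finite_subset[OF set_bernoulli_cube]) simp

lemma integrable_bernoulli_cube [simp]:
  "integrable (measure_pmf (bernoulli_cube n p)) (g :: _ \<Rightarrow> real)"
  by (rule integrable_measure_pmf_finite) simp

lemma expectation_bind_finite:
  fixes h :: "'b \<Rightarrow> real"
  assumes "finite (set_pmf M)" "\<And>x. finite (set_pmf (K x))"
  shows "measure_pmf.expectation (M \<bind> K) h =
    measure_pmf.expectation M (\<lambda>x. measure_pmf.expectation (K x) h)"
  using assms by (simp add: pmf_expectation_bind[of "set_pmf M"] integral_measure_pmf[of "set_pmf M"])

text \<open>Coordinate \<open>j\<close> is independent of the others, so its value can be averaged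
  out explicitly. The inductions below that involve expectations peel off one coordinate this
  way.\<close>

lemma expectation_resample:
  fixes g :: "(nat \<Rightarrow> bool) \<Rightarrow> real"
  assumes j: "j \<in> {1..n}" and p: "0 \<le> p" "p \<le> 1"
  shows "measure_pmf.expectation (bernoulli_cube n p) g =
    measure_pmf.expectation (bernoulli_cube n p)
      (\<lambda>\<omega>. p * g (fun_upd \<omega> j True) + (1 - p) * g (fun_upd \<omega> j False))"
proof -
  define Q where "Q = Pi_pmf ({1..n} - {j}) False (\<lambda>_. bernoulli_pmf p)"
  have fin: "finite (set_pmf Q)" unfolding Q_def
    by (rule finite_subset[OF set_Pi_pmf_subset']) (auto intro!: finite_PiE_dflt)
  have eq: "bernoulli_cube n p = bernoulli_pmf p \<bind> (\<lambda>b. Q \<bind> (\<lambda>\<omega>. return_pmf (fun_upd \<omega> j b)))"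
    unfolding bernoulli_cube_def Q_def
    by (subst Pi_pmf_insert'[symmetric]) (use j in \<open>auto simp: insert_absorb\<close>)
  have int [simp]: "integrable (measure_pmf Q) h" for h :: "_ \<Rightarrow> real"
    by (rule integrable_measure_pmf_finite[OF fin])
  have fb: "finite (set_pmf (bernoulli_pmf p))"
    by (rule finite_subset[OF subset_UNIV]) simp
  have *: "measure_pmf.expectation (bernoulli_cube n p) h =
    measure_pmf.expectation Q (\<lambda>\<omega>. p * h (fun_upd \<omega> j True) + (1 - p) * h (fun_upd \<omega> j False))"
    for h :: "_ \<Rightarrow> real"
    unfolding eq using fin fb p
    by (simp add: expectation_bind_finite mult.commute)
  \<comment> \<open>Applying \<open>*\<close> to the right-hand side averages over \<open>j\<close>
    twice; the later update at \<open>j\<close> wins, so one of the two averages is over a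
    constant.\<close>
  have "p * x + (1 - p) * x = x" for x :: real by (simp add: algebra_simps)
  then show ?thesis
    unfolding * fun_upd_upd by simp
qed

lemma expectation_Cauchy_Schwarz:
  fixes X Y :: "(nat \<Rightarrow> bool) \<Rightarrow> real"
  shows "(measure_pmf.expectation (bernoulli_cube n p) (\<lambda>\<omega>. X \<omega> * Y \<omega>))\<^sup>2
    \<le> measure_pmf.expectation (bernoulli_cube n p) (\<lambda>\<omega>. (X \<omega>)\<^sup>2)
      * measure_pmf.expectation (bernoulli_cube n p) (\<lambda>\<omega>. (Y \<omega>)\<^sup>2)"
proof -
  let ?w = "pmf (bernoulli_cube n p)"
  have *: "measure_pmf.expectation (bernoulli_cube n p) h = (\<Sum>\<omega>\<in>cube n. ?w \<omega> * h \<omega>)"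
    for h :: "_ \<Rightarrow> real"
    using set_bernoulli_cube[of n p] by (subst integral_measure_pmf[of "cube n"]) auto
  have "(\<Sum>\<omega>\<in>cube n. (sqrt (?w \<omega>) * X \<omega>) * (sqrt (?w \<omega>) * Y \<omega>))\<^sup>2 \<le>
     (\<Sum>\<omega>\<in>cube n. (sqrt (?w \<omega>) * X \<omega>)\<^sup>2) * (\<Sum>\<omega>\<in>cube n. (sqrt (?w \<omega>) * Y \<omega>)\<^sup>2)"
    by (rule Cauchy_Schwarz_ineq_sum)
  moreover have "(sqrt (?w \<omega>) * X \<omega>) * (sqrt (?w \<omega>) * Y \<omega>) = ?w \<omega> * (X \<omega> * Y \<omega>)" for \<omega>
  proof -
    have "(sqrt (?w \<omega>) * X \<omega>) * (sqrt (?w \<omega>) * Y \<omega>) = (sqrt (?w \<omega>))\<^sup>2 * (X \<omega> * Y \<omega>)"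
      by (simp add: power2_eq_square)
    then show ?thesis by simp
  qed
  ultimately show ?thesis
    unfolding * by (simp add: power_mult_distrib)
qed

text \<open>This is Hoelder with exponents 4 and 4/3 combined with interpolation of L^(4/3) between
  L^1 and L^2. Two uses of Cauchy-Schwarz replace both: first split \<open>v * u\<close> as
  \<open>(v * sqrt \<bar>u\<bar>) * (sgn u * sqrt \<bar>u\<bar>)\<close>, then separate
  \<open>v\<^sup>2\<close> from \<open>\<bar>u\<bar>\<close>.\<close>

lemma expectation_mult_fourth_le:
  fixes v u :: "(nat \<Rightarrow> bool) \<Rightarrow> real" and n :: nat and p :: real
  defines "E \<equiv> measure_pmf.expectation (bernoulli_cube n p)"
  shows "(E (\<lambda>\<omega>. v \<omega> * u \<omega>)) ^ 4 \<le> E (\<lambda>\<omega>. (v \<omega>) ^ 4) * E (\<lambda>\<omega>. (u \<omega>)\<^sup>2) * (E (\<lambda>\<omega>. \<bar>u \<omega>\<bar>))\<^sup>2"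
proof -
  have "(E (\<lambda>\<omega>. v \<omega> * u \<omega>))\<^sup>2 = (E (\<lambda>\<omega>. (v \<omega> * sqrt \<bar>u \<omega>\<bar>) * (sgn (u \<omega>) * sqrt \<bar>u \<omega>\<bar>)))\<^sup>2"
    by (intro arg_cong[of _ _ "\<lambda>x. x\<^sup>2"] arg_cong[of _ _ E] ext) (auto simp: sgn_if)
  also have "\<dots> \<le> E (\<lambda>\<omega>. (v \<omega> * sqrt \<bar>u \<omega>\<bar>)\<^sup>2) * E (\<lambda>\<omega>. (sgn (u \<omega>) * sqrt \<bar>u \<omega>\<bar>)\<^sup>2)"
    unfolding E_def by (rule expectation_Cauchy_Schwarz)
  also have "\<dots> = E (\<lambda>\<omega>. (v \<omega>)\<^sup>2 * \<bar>u \<omega>\<bar>) * E (\<lambda>\<omega>. \<bar>u \<omega>\<bar>)"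
    by (intro arg_cong2[of _ _ _ _ "(*)"] arg_cong[of _ _ E] ext)
       (auto simp: power_mult_distrib sgn_if)
  finally have 1: "(E (\<lambda>\<omega>. v \<omega> * u \<omega>))\<^sup>2 \<le> E (\<lambda>\<omega>. (v \<omega>)\<^sup>2 * \<bar>u \<omega>\<bar>) * E (\<lambda>\<omega>. \<bar>u \<omega>\<bar>)" .
  have 2: "(E (\<lambda>\<omega>. (v \<omega>)\<^sup>2 * \<bar>u \<omega>\<bar>))\<^sup>2 \<le> E (\<lambda>\<omega>. (v \<omega>) ^ 4) * E (\<lambda>\<omega>. (u \<omega>)\<^sup>2)"
    using expectation_Cauchy_Schwarz[of n p "\<lambda>\<omega>. (v \<omega>)\<^sup>2" "\<lambda>\<omega>. \<bar>u \<omega>\<bar>"]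
    by (simp add: E_def flip: power_mult)
  have "((E (\<lambda>\<omega>. v \<omega> * u \<omega>))\<^sup>2)\<^sup>2 \<le> (E (\<lambda>\<omega>. (v \<omega>)\<^sup>2 * \<bar>u \<omega>\<bar>) * E (\<lambda>\<omega>. \<bar>u \<omega>\<bar>))\<^sup>2"
    by (rule power_mono[OF 1]) simp
  also have "\<dots> \<le> E (\<lambda>\<omega>. (v \<omega>) ^ 4) * E (\<lambda>\<omega>. (u \<omega>)\<^sup>2) * (E (\<lambda>\<omega>. \<bar>u \<omega>\<bar>))\<^sup>2"
    unfolding power_mult_distrib by (rule mult_right_mono[OF 2]) simp
  finally show ?thesis by (simp flip: power_mult)
qed

lemma expectation_cong_cube:
  fixes g h :: "(nat \<Rightarrow> bool) \<Rightarrow> real"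
  assumes "\<And>\<omega>. \<omega> \<in> cube n \<Longrightarrow> g \<omega> = h \<omega>"
  shows "measure_pmf.expectation (bernoulli_cube n p) g = measure_pmf.expectation (bernoulli_cube n p) h"
  using assms set_bernoulli_cube[of n p]
  by (intro integral_cong_AE) (auto simp: AE_measure_pmf_iff)

lemma set_noise_pair: "set_pmf (noise_pair n p \<epsilon>) \<subseteq> cube n \<times> cube n"
  using set_bernoulli_cube[of n p] by (auto simp: noise_pair_def cube_iff subset_eq)

lemma sum_Pow_insert:
  fixes g :: "'a set \<Rightarrow> real"
  assumes "finite A" "j \<notin> A"
  shows "(\<Sum>S\<in>Pow (insert j A). g S) = (\<Sum>S\<in>Pow A. g S) + (\<Sum>S\<in>Pow A. g (insert j S))"
proof -
  have "inj_on (insert j) (Pow A)"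
  proof (rule inj_onI)
    fix S T assume *: "S \<in> Pow A" "T \<in> Pow A" "insert j S = insert j T"
    then have "j \<notin> S" "j \<notin> T" using assms by auto
    with *(3) show "S = T" by (simp add: insert_ident)
  qed
  moreover have "Pow A \<inter> insert j ` Pow A = {}" using assms by auto
  ultimately show ?thesis
    using assms by (simp add: Pow_insert sum.union_disjoint sum.reindex)
qed

text \<open>Double counting of pairs \<open>i \<in> S\<close>: it converts a sum over coordinates of
  derivative weights into a spectral sum weighted by level.\<close>

lemma sum_containing:
  fixes g :: "'a set \<Rightarrow> real"
  assumes "finite A"
  shows "(\<Sum>i\<in>A. \<Sum>S\<in>Pow A. if i \<in> S then g S else 0) = (\<Sum>S\<in>Pow A. card S * g S)"
proof -
  have "(\<Sum>i\<in>A. \<Sum>S\<in>Pow A. if i \<in> S then g S else 0) = (\<Sum>S\<in>Pow A. \<Sum>i\<in>A. if i \<in> S then g S else 0)"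
    by (rule sum.swap)
  also have "\<dots> = (\<Sum>S\<in>Pow A. card S * g S)"
  proof (rule sum.cong)
    fix S assume "S \<in> Pow A"
    then have "A \<inter> S = S" by auto
    with assms show "(\<Sum>i\<in>A. if i \<in> S then g S else 0) = card S * g S"
      by (simp flip: sum.inter_restrict)
  qed simp
  finally show ?thesis .
qed

subsection \<open>Biased Fourier expansions\<close>

locale biased_cube =
  fixes n :: nat and p :: real
  assumes p0: "0 < p" and p1: "p < 1"
begin

abbreviation E :: "((nat \<Rightarrow> bool) \<Rightarrow> real) \<Rightarrow> real" where
  "E \<equiv> measure_pmf.expectation (bernoulli_cube n p)"

text \<open>Up to a global sign these are the only two values giving mean zero and variance one
  under Bernoulli(\<open>p\<close>).\<close>

definition phi :: "bool \<Rightarrow> real" where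
  "phi b = (if b then sqrt ((1 - p) / p) else - sqrt (p / (1 - p)))"

definition chi :: "nat set \<Rightarrow> (nat \<Rightarrow> bool) \<Rightarrow> real" where
  "chi S \<omega> = (\<Prod>i\<in>S. phi (\<omega> i))"

text \<open>The coordinate set \<open>A\<close> is kept general, instead of \<open>{1..n}\<close>,
  so that proofs can induct by inserting one coordinate at a time.\<close>

definition fourier :: "nat set \<Rightarrow> (nat set \<Rightarrow> real) \<Rightarrow> (nat \<Rightarrow> bool) \<Rightarrow> real" where
  "fourier A c \<omega> = (\<Sum>S\<in>Pow A. c S * chi S \<omega>)"

lemma phi_mean: "p * phi True + (1 - p) * phi False = 0"
proof -
  have *: "a * sqrt (b / a) = sqrt (a * b)" if "a > 0" for a b :: real
  proof -
    have "a * sqrt (b / a) = sqrt (a\<^sup>2 * (b / a))"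
      using that by (simp only: real_sqrt_mult real_sqrt_abs abs_of_pos)
    also have "a\<^sup>2 * (b / a) = a * b"
      using that by (simp add: power2_eq_square)
    finally show ?thesis .
  qed
  show ?thesis
    using *[of p "1 - p"] *[of "1 - p" p] p0 p1 by (simp add: phi_def mult.commute)
qed

lemma phi_var: "p * (phi True)\<^sup>2 + (1 - p) * (phi False)\<^sup>2 = 1"
  using p0 p1 by (simp add: phi_def)

lemma phi_signs: "phi True > 0" "phi False < 0"
  using p0 p1 by (auto simp: phi_def)

lemma chi_insert: "finite S \<Longrightarrow> j \<notin> S \<Longrightarrow> chi (insert j S) \<omega> = phi (\<omega> j) * chi S \<omega>"
  by (simp add: chi_def)

lemma chi_upd: "j \<notin> S \<Longrightarrow> chi S (fun_upd \<omega> j b) = chi S \<omega>"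
  unfolding chi_def by (rule prod.cong) auto

lemma fourier_upd: "j \<notin> A \<Longrightarrow> fourier A c (fun_upd \<omega> j b) = fourier A c \<omega>"
  unfolding fourier_def by (rule sum.cong) (auto intro!: chi_upd)

lemma fourier_insert:
  assumes "finite A" "j \<notin> A"
  shows "fourier (insert j A) c \<omega> =
    fourier A c \<omega> + phi (\<omega> j) * fourier A (\<lambda>S. c (insert j S)) \<omega>"
  unfolding fourier_def sum_Pow_insert[OF assms] sum_distrib_left
proof (intro arg_cong2[of _ _ _ _ "(+)"] refl sum.cong)
  fix S assume "S \<in> Pow A"
  then have "finite S" "j \<notin> S" using assms finite_subset by auto
  then show "c (insert j S) * chi (insert j S) \<omega> = phi (\<omega> j) * (c (insert j S) * chi S \<omega>)"
    by (simp add: chi_insert)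
qed

lemma fourier_linear:
  "fourier A (\<lambda>S. a * c S + b * d S) \<omega> = a * fourier A c \<omega> + b * fourier A d \<omega>"
  by (simp add: fourier_def algebra_simps sum.distrib sum_distrib_left)

text \<open>Any function of one bit is affine in \<open>phi\<close> of that bit, because
  \<open>phi\<close> takes two distinct values. Expanding the two restrictions at \<open>j\<close>
  by induction and interpolating gives the expansion on \<open>insert j A\<close>.\<close>

lemma fourier_expansion:
  assumes "finite A"
  shows "\<exists>c. \<forall>\<omega>. (\<forall>i. i \<notin> A \<longrightarrow> \<not> \<omega> i) \<longrightarrow> f \<omega> = fourier A c \<omega>"
  using assms
proof (induction A arbitrary: f rule: finite_induct)
  case empty
  show ?case
  proof (intro exI allI impI)
    fix \<omega> :: "nat \<Rightarrow> bool" assume "\<forall>i. i \<notin> {} \<longrightarrow> \<not> \<omega> i"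
    then have \<omega>: "\<omega> = (\<lambda>_. False)" by auto
    show "f \<omega> = fourier {} (\<lambda>_. f (\<lambda>_. False)) \<omega>"
      by (simp add: \<omega> fourier_def chi_def)
  qed
next
  case (insert j A)
  obtain c1 where c1: "\<And>\<omega>. (\<forall>i. i \<notin> A \<longrightarrow> \<not> \<omega> i) \<Longrightarrow> f (fun_upd \<omega> j True) = fourier A c1 \<omega>"
    using insert.IH[of "\<lambda>\<omega>. f (fun_upd \<omega> j True)"] by auto
  obtain c0 where c0: "\<And>\<omega>. (\<forall>i. i \<notin> A \<longrightarrow> \<not> \<omega> i) \<Longrightarrow> f (fun_upd \<omega> j False) = fourier A c0 \<omega>"
    using insert.IH[of "\<lambda>\<omega>. f (fun_upd \<omega> j False)"] by auto
  define D where "D = phi True - phi False"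
  have D: "D > 0" using phi_signs by (simp add: D_def)
  \<comment> \<open>\<open>a\<close> and \<open>b\<close> solve \<open>a + phi True * b = c1\<close>
    and \<open>a + phi False * b = c0\<close>.\<close>
  define a where "a = (\<lambda>S. (- phi False / D) * c1 S + (phi True / D) * c0 S)"
  define b where "b = (\<lambda>S. (1 / D) * c1 S + (- 1 / D) * c0 S)"
  define c where "c = (\<lambda>S. if j \<in> S then b (S - {j}) else a S)"
  show ?case
  proof (intro exI[of _ c] allI impI)
    fix \<omega> assume \<omega>: "\<forall>i. i \<notin> insert j A \<longrightarrow> \<not> \<omega> i"
    \<comment> \<open>The induction hypothesis only covers configurations that are
      \<open>False\<close> outside \<open>A\<close>, so coordinate \<open>j\<close> is
      reset.\<close>
    define \<omega>' where "\<omega>' = fun_upd \<omega> j False"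
    have \<omega>': "\<forall>i. i \<notin> A \<longrightarrow> \<not> \<omega>' i" using \<omega> by (auto simp: \<omega>'_def)
    have upd: "fourier A d \<omega> = fourier A d \<omega>'" for d
      using insert.hyps by (simp add: \<omega>'_def fourier_upd)
    have "c S = a S" "c (insert j S) = b S" if "S \<in> Pow A" for S
    proof -
      have "j \<notin> S" using that insert.hyps by auto
      then show "c S = a S" "c (insert j S) = b S" by (simp_all add: c_def)
    qed
    then have "fourier A c \<omega> = fourier A a \<omega>" "fourier A (\<lambda>S. c (insert j S)) \<omega> = fourier A b \<omega>"
      unfolding fourier_def by simp_all
    then have "fourier (insert j A) c \<omega> = fourier A a \<omega>' + phi (\<omega> j) * fourier A b \<omega>'"
      using insert.hyps by (simp add: fourier_insert upd)
    also have "\<dots> = (if \<omega> j then fourier A c1 \<omega>' else fourier A c0 \<omega>')"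
    proof -
      have "- s / d * x + t / d * y + t * (1 / d * x + - 1 / d * y) = (t - s) / d * x"
        and "- s / d * x + t / d * y + s * (1 / d * x + - 1 / d * y) = (t - s) / d * y"
        for s t x y d :: real
        by (simp_all add: algebra_simps diff_divide_distrib)
      from this[where s = "phi False" and t = "phi True" and d = D] show ?thesis
        unfolding a_def b_def fourier_linear using D by (simp flip: D_def)
    qed
    also have "\<dots> = f \<omega>"
    proof -
      have "fun_upd \<omega>' j (\<omega> j) = \<omega>" by (simp add: \<omega>'_def)
      with c1[OF \<omega>'] c0[OF \<omega>'] show ?thesis by (cases "\<omega> j") auto
    qed
    finally show "f \<omega> = fourier (insert j A) c \<omega>" by simp
  qed
qed

text \<open>The functions 1 and \<open>phi\<close> are orthonormal in a single coordinate, so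
  averaging over \<open>j\<close> removes the cross terms and leaves two products over
  \<open>A\<close>. Coordinates outside \<open>{1..n}\<close> are frozen at \<open>False\<close>,
  where \<open>phi\<close> has no mean zero, hence the range of \<open>A\<close>.\<close>

lemma parseval:
  assumes "finite A" "A \<subseteq> {1..n}"
  shows "E (\<lambda>\<omega>. fourier A c \<omega> * fourier A d \<omega>) = (\<Sum>S\<in>Pow A. c S * d S)"
  using assms
proof (induction A arbitrary: c d rule: finite_induct)
  case empty
  then show ?case by (simp add: fourier_def chi_def)
next
  case (insert j A)
  let ?c = "\<lambda>S. c (insert j S)" and ?d = "\<lambda>S. d (insert j S)"
  have pw: "p * ((x + phi True * y) * (x' + phi True * y'))
     + (1 - p) * ((x + phi False * y) * (x' + phi False * y')) = x * x' + y * y'" for x y x' y'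
  proof -
    have "p * ((x + phi True * y) * (x' + phi True * y'))
     + (1 - p) * ((x + phi False * y) * (x' + phi False * y'))
     = x * x' + (p * phi True + (1 - p) * phi False) * (x * y' + y * x')
       + (p * (phi True)\<^sup>2 + (1 - p) * (phi False)\<^sup>2) * (y * y')"
      by (simp add: algebra_simps power2_eq_square)
    then show ?thesis by (simp add: phi_mean phi_var)
  qed
  have "E (\<lambda>\<omega>. fourier (insert j A) c \<omega> * fourier (insert j A) d \<omega>) =
     E (\<lambda>\<omega>. fourier A c \<omega> * fourier A d \<omega> + fourier A ?c \<omega> * fourier A ?d \<omega>)"
    by (subst expectation_resample[of j])
       (use insert p0 p1 in \<open>auto simp: fourier_insert fourier_upd pw\<close>)
  then show ?case
    using insert by (simp add: sum_Pow_insert)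
qed

section \<open>Hypercontractivity from L^2 to L^4\<close>

lemma fourth_power_average:
  assumes r: "\<And>b. \<bar>r * phi b\<bar> \<le> 1 / 4"
  shows "p * (x + phi True * (r * y)) ^ 4 + (1 - p) * (x + phi False * (r * y)) ^ 4
    \<le> x ^ 4 + 2 * (x\<^sup>2 * y\<^sup>2) + y ^ 4"
proof -
  \<comment> \<open>The term linear in \<open>t\<close> is kept exactly because it averages to zero
    once \<open>t = r * phi b\<close>. The others are absorbed using
    \<open>\<bar>t\<bar> \<le> 1 / 4\<close>: the coefficient of
    \<open>x\<^sup>2 * y\<^sup>2\<close> is at most 6/16 + 1/32, that of \<open>y ^ 4\<close> at
    most 1/32 + 1/256.\<close>
  have bd: "(x + t * y) ^ 4 \<le> x ^ 4 + 4 * x ^ 3 * y * t + 2 * (x\<^sup>2 * y\<^sup>2) + y ^ 4"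
    if t: "\<bar>t\<bar> \<le> 1 / 4" for t
  proof -
    have t2: "t\<^sup>2 \<le> 1 / 16" using power_mono[OF t, of 2] by (simp add: power2_eq_square)
    have t3: "\<bar>t ^ 3\<bar> \<le> 1 / 64" using power_mono[OF t, of 3] by (simp add: power_abs power_divide)
    have t4: "t ^ 4 \<le> 1 / 256" using power_mono[OF t, of 4] by (simp add: eval_nat_numeral)
    have "2 * \<bar>x * y\<bar> * y\<^sup>2 \<le> x\<^sup>2 * y\<^sup>2 + y ^ 4"
    proof -
      have "0 \<le> (\<bar>x * y\<bar> - y\<^sup>2)\<^sup>2" by simp
      also have "\<dots> = x\<^sup>2 * y\<^sup>2 + y ^ 4 - 2 * \<bar>x * y\<bar> * y\<^sup>2"
        by (simp add: power2_diff power_mult_distrib flip: power_mult)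
      finally show ?thesis by simp
    qed
    then have xy: "\<bar>x * y ^ 3\<bar> \<le> (x\<^sup>2 * y\<^sup>2 + y ^ 4) / 2"
      by (simp add: abs_mult power3_eq_cube power2_eq_square mult_ac)
    have "4 * (x * y ^ 3) * t ^ 3 \<le> 4 * (\<bar>x * y ^ 3\<bar> * \<bar>t ^ 3\<bar>)"
      by (simp flip: abs_mult)
    also have "\<dots> \<le> 4 * ((x\<^sup>2 * y\<^sup>2 + y ^ 4) / 2 * (1 / 64))"
      by (intro mult_left_mono mult_mono xy t3) auto
    finally have 3: "4 * (x * y ^ 3) * t ^ 3 \<le> (x\<^sup>2 * y\<^sup>2 + y ^ 4) / 32" by simp
    have 2: "x\<^sup>2 * y\<^sup>2 * t\<^sup>2 \<le> x\<^sup>2 * y\<^sup>2 * (1 / 16)" by (intro mult_left_mono t2) auto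
    have 4: "y ^ 4 * t ^ 4 \<le> y ^ 4 * (1 / 256)" by (intro mult_left_mono t4) auto
    have "(x + t * y) ^ 4 = x ^ 4 + 4 * x ^ 3 * y * t + 6 * (x\<^sup>2 * y\<^sup>2 * t\<^sup>2)
        + 4 * (x * y ^ 3) * t ^ 3 + y ^ 4 * t ^ 4"
      by algebra
    moreover have "X + 6 * Z + W + V \<le> X + 2 * P + Q"
      if "Z \<le> P * (1 / 16)" "W \<le> (P + Q) / 32" "V \<le> Q * (1 / 256)" "0 \<le> P" "0 \<le> Q"
      for X Z W V P Q :: real
      using that by simp
    note this[OF 2 3 4, of "x ^ 4 + 4 * x ^ 3 * y * t"]
    ultimately show ?thesis by simp
  qed
  let ?R = "\<lambda>b. x ^ 4 + 4 * x ^ 3 * y * (r * phi b) + 2 * (x\<^sup>2 * y\<^sup>2) + y ^ 4"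
  have "p * (x + (r * phi True) * y) ^ 4 + (1 - p) * (x + (r * phi False) * y) ^ 4
      \<le> p * ?R True + (1 - p) * ?R False"
    using p0 p1 by (intro add_mono mult_left_mono bd r) auto
  also have "\<dots> = x ^ 4 + 2 * (x\<^sup>2 * y\<^sup>2) + y ^ 4
      + 4 * x ^ 3 * y * r * (p * phi True + (1 - p) * phi False)"
    by algebra
  finally show ?thesis by (simp add: phi_mean mult_ac)
qed

text \<open>The two-point inequality is tensorised by induction: averaging over \<open>j\<close>
  leaves two pure fourth moments and a mixed one, Cauchy-Schwarz bounds the mixed one by
  \<open>?a * ?b\<close>, and the three terms complete a square. By \<open>parseval\<close> the
  right-hand side is the fourth power of an L^2 norm.\<close>

lemma hypercontractive:
  assumes r: "\<And>b. \<bar>r * phi b\<bar> \<le> 1 / 4"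
  assumes "finite A" "A \<subseteq> {1..n}"
  shows "E (\<lambda>\<omega>. (fourier A (\<lambda>S. r ^ card S * c S) \<omega>) ^ 4) \<le> (\<Sum>S\<in>Pow A. (c S)\<^sup>2)\<^sup>2"
  using assms(2,3)
proof (induction A arbitrary: c rule: finite_induct)
  case empty
  then show ?case by (simp add: fourier_def chi_def flip: power_mult)
next
  case (insert j A)
  let ?c = "\<lambda>S. c (insert j S)"
  let ?X = "fourier A (\<lambda>S. r ^ card S * c S)" and ?Y = "fourier A (\<lambda>S. r ^ card S * ?c S)"
  let ?a = "\<Sum>S\<in>Pow A. (c S)\<^sup>2" and ?b = "\<Sum>S\<in>Pow A. (?c S)\<^sup>2"
  \<comment> \<open>Inserting \<open>j\<close> raises the level by one; the extra \<open>r\<close>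
    is the one that accompanies \<open>phi\<close> in the two-point inequality.\<close>
  have ins: "fourier A (\<lambda>S. r ^ card (insert j S) * ?c S) \<omega> = r * ?Y \<omega>" for \<omega>
    unfolding fourier_def sum_distrib_left
  proof (rule sum.cong)
    fix S assume "S \<in> Pow A"
    then have "finite S" "j \<notin> S" using insert.hyps finite_subset by auto
    then show "r ^ card (insert j S) * ?c S * chi S \<omega> = r * (r ^ card S * ?c S * chi S \<omega>)" by simp
  qed simp
  have X: "E (\<lambda>\<omega>. ?X \<omega> ^ 4) \<le> ?a\<^sup>2" and Y: "E (\<lambda>\<omega>. ?Y \<omega> ^ 4) \<le> ?b\<^sup>2"
    using insert by auto
  have "(E (\<lambda>\<omega>. (?X \<omega>)\<^sup>2 * (?Y \<omega>)\<^sup>2))\<^sup>2 \<le> E (\<lambda>\<omega>. ?X \<omega> ^ 4) * E (\<lambda>\<omega>. ?Y \<omega> ^ 4)"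
    using expectation_Cauchy_Schwarz[of n p "\<lambda>\<omega>. (?X \<omega>)\<^sup>2" "\<lambda>\<omega>. (?Y \<omega>)\<^sup>2"]
    by (simp flip: power_mult)
  also have "\<dots> \<le> ?a\<^sup>2 * ?b\<^sup>2"
    by (intro mult_mono X Y) auto
  finally have XY: "E (\<lambda>\<omega>. (?X \<omega>)\<^sup>2 * (?Y \<omega>)\<^sup>2) \<le> ?a * ?b"
    unfolding power_mult_distrib[symmetric]
    by (rule power2_le_imp_le) (auto intro!: mult_nonneg_nonneg sum_nonneg)
  have "E (\<lambda>\<omega>. (fourier (insert j A) (\<lambda>S. r ^ card S * c S) \<omega>) ^ 4)
    = E (\<lambda>\<omega>. p * (?X \<omega> + phi True * (r * ?Y \<omega>)) ^ 4 + (1 - p) * (?X \<omega> + phi False * (r * ?Y \<omega>)) ^ 4)"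
    by (subst expectation_resample[of j])
       (use insert p0 p1 in \<open>auto simp: fourier_insert fourier_upd ins\<close>)
  also have "\<dots> \<le> E (\<lambda>\<omega>. ?X \<omega> ^ 4 + 2 * ((?X \<omega>)\<^sup>2 * (?Y \<omega>)\<^sup>2) + ?Y \<omega> ^ 4)"
    by (intro integral_mono fourth_power_average r) auto
  also have "\<dots> = E (\<lambda>\<omega>. ?X \<omega> ^ 4) + 2 * E (\<lambda>\<omega>. (?X \<omega>)\<^sup>2 * (?Y \<omega>)\<^sup>2) + E (\<lambda>\<omega>. ?Y \<omega> ^ 4)"
    by simp
  also have "\<dots> \<le> ?a\<^sup>2 + 2 * (?a * ?b) + ?b\<^sup>2"
    using X Y XY by linarith
  also have "\<dots> = (\<Sum>S\<in>Pow (insert j A). (c S)\<^sup>2)\<^sup>2"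
    using insert.hyps by (simp add: sum_Pow_insert power2_sum)
  finally show ?case .
qed

section \<open>Averaging over a coordinate, L^1 contraction and influences\<close>

lemma fourier_average:
  assumes "finite A"
  shows "p * fourier A c (fun_upd \<omega> j True) + (1 - p) * fourier A c (fun_upd \<omega> j False)
    = fourier A (\<lambda>S. if j \<in> S then 0 else c S) \<omega>"
proof -
  have chi: "p * chi S (fun_upd \<omega> j True) + (1 - p) * chi S (fun_upd \<omega> j False)
      = (if j \<in> S then 0 else chi S \<omega>)" if "finite S" for S
  proof (cases "j \<in> S")
    case True
    then have S: "S = insert j (S - {j})" by auto
    have "chi S (fun_upd \<omega> j b) = phi b * chi (S - {j}) \<omega>" for b
      by (subst S, subst chi_insert) (use that in \<open>auto simp: chi_upd\<close>)
    then have "p * chi S (fun_upd \<omega> j True) + (1 - p) * chi S (fun_upd \<omega> j False)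
        = (p * phi True + (1 - p) * phi False) * chi (S - {j}) \<omega>"
      by (simp add: algebra_simps)
    then show ?thesis using True by (simp add: phi_mean)
  next
    case False
    then show ?thesis by (simp add: chi_upd algebra_simps)
  qed
  have "p * fourier A c (fun_upd \<omega> j True) + (1 - p) * fourier A c (fun_upd \<omega> j False)
    = (\<Sum>S\<in>Pow A. c S * (p * chi S (fun_upd \<omega> j True) + (1 - p) * chi S (fun_upd \<omega> j False)))"
    by (simp add: fourier_def sum_distrib_left distrib_left mult.left_commute flip: sum.distrib)
  also have "\<dots> = fourier A (\<lambda>S. if j \<in> S then 0 else c S) \<omega>"
    unfolding fourier_def
  proof (rule sum.cong)
    fix S assume "S \<in> Pow A"
    then have "finite S" using assms finite_subset by auto
    then show "c S * (p * chi S (fun_upd \<omega> j True) + (1 - p) * chi S (fun_upd \<omega> j False))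
      = (if j \<in> S then 0 else c S) * chi S \<omega>" by (simp add: chi)
  qed simp
  finally show ?thesis .
qed

lemma expectation_abs_average_le:
  assumes "j \<in> {1..n}"
  shows "E (\<lambda>\<omega>. \<bar>p * g (fun_upd \<omega> j True) + (1 - p) * g (fun_upd \<omega> j False)\<bar>) \<le> E (\<lambda>\<omega>. \<bar>g \<omega>\<bar>)"
proof -
  have "E (\<lambda>\<omega>. \<bar>p * g (fun_upd \<omega> j True) + (1 - p) * g (fun_upd \<omega> j False)\<bar>)
    \<le> E (\<lambda>\<omega>. p * \<bar>g (fun_upd \<omega> j True)\<bar> + (1 - p) * \<bar>g (fun_upd \<omega> j False)\<bar>)"
  proof (rule integral_mono)
    fix \<omega>
    show "\<bar>p * g (fun_upd \<omega> j True) + (1 - p) * g (fun_upd \<omega> j False)\<bar>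
      \<le> p * \<bar>g (fun_upd \<omega> j True)\<bar> + (1 - p) * \<bar>g (fun_upd \<omega> j False)\<bar>"
      using p0 p1 by (intro order_trans[OF abs_triangle_ineq]) (simp add: abs_mult)
  qed auto
  also have "\<dots> = E (\<lambda>\<omega>. \<bar>g \<omega>\<bar>)"
    by (rule expectation_resample[symmetric]) (use assms p0 p1 in auto)
  finally show ?thesis .
qed

text \<open>The multiplier \<open>r ^ card S\<close> is a composition over \<open>j\<close> of \<open>r + (1 - r) E\<^sub>j\<close>, where \<open>E\<^sub>j\<close> averages
  over coordinate \<open>j\<close>.\<close>

lemma noise_contraction_L1:
  assumes r: "0 \<le> r" "r \<le> 1" and A: "finite A" and B: "finite B" "B \<subseteq> {1..n}"
  shows "E (\<lambda>\<omega>. \<bar>fourier A (\<lambda>S. r ^ card (S \<inter> B) * c S) \<omega>\<bar>) \<le> E (\<lambda>\<omega>. \<bar>fourier A c \<omega>\<bar>)"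
  using B
proof (induction B rule: finite_induct)
  case empty
  then show ?case by simp
next
  case (insert j B)
  let ?d = "\<lambda>S. r ^ card (S \<inter> B) * c S"
  let ?g = "fourier A ?d"
  let ?a = "\<lambda>\<omega>. p * ?g (fun_upd \<omega> j True) + (1 - p) * ?g (fun_upd \<omega> j False)"
  \<comment> \<open>If \<open>j \<in> S\<close> only the first term survives and supplies the new
    factor \<open>r\<close>; otherwise the weights add up to 1.\<close>
  have "r ^ card (S \<inter> insert j B) * c S = r * ?d S + (1 - r) * (if j \<in> S then 0 else ?d S)" for S
    using insert.hyps by (auto simp: algebra_simps)
  then have eq: "fourier A (\<lambda>S. r ^ card (S \<inter> insert j B) * c S) \<omega> = r * ?g \<omega> + (1 - r) * ?a \<omega>" for \<omega>
    unfolding fourier_average[OF A] by (simp only: fourier_linear)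
  have "E (\<lambda>\<omega>. \<bar>fourier A (\<lambda>S. r ^ card (S \<inter> insert j B) * c S) \<omega>\<bar>)
    \<le> E (\<lambda>\<omega>. r * \<bar>?g \<omega>\<bar> + (1 - r) * \<bar>?a \<omega>\<bar>)"
    unfolding eq
  proof (rule integral_mono)
    fix \<omega>
    show "\<bar>r * ?g \<omega> + (1 - r) * ?a \<omega>\<bar> \<le> r * \<bar>?g \<omega>\<bar> + (1 - r) * \<bar>?a \<omega>\<bar>"
      using r abs_triangle_ineq[of "r * ?g \<omega>" "(1 - r) * ?a \<omega>"] by (simp only: abs_mult)
  qed auto
  also have "\<dots> = r * E (\<lambda>\<omega>. \<bar>?g \<omega>\<bar>) + (1 - r) * E (\<lambda>\<omega>. \<bar>?a \<omega>\<bar>)"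
    by simp
  also have "\<dots> \<le> r * E (\<lambda>\<omega>. \<bar>?g \<omega>\<bar>) + (1 - r) * E (\<lambda>\<omega>. \<bar>?g \<omega>\<bar>)"
    using r insert.prems by (intro add_left_mono mult_left_mono expectation_abs_average_le) auto
  also have "\<dots> = E (\<lambda>\<omega>. \<bar>?g \<omega>\<bar>)" by (simp add: algebra_simps)
  also have "\<dots> \<le> E (\<lambda>\<omega>. \<bar>fourier A c \<omega>\<bar>)" using insert by auto
  finally show ?case .
qed

text \<open>The terms with \<open>i \<in> S\<close> form the function minus its average over
  coordinate \<open>i\<close>. That is the difference across the flip times the probability that a
  fresh value at \<open>i\<close> differs from the current one, a factor at most 1.\<close>

lemma expectation_derivative_le_influence:
  assumes "finite A"
  shows "E (\<lambda>\<omega>. \<bar>fourier A (\<lambda>S. if i \<in> S then c S else 0) \<omega>\<bar>) \<le> influence n p i (fourier A c)"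
  unfolding influence_def
proof (rule integral_mono)
  fix \<omega>
  let ?F = "fourier A c"
  have "fourier A (\<lambda>S. if i \<in> S then c S else 0) \<omega>
    = fourier A (\<lambda>S. 1 * c S + (- 1) * (if i \<in> S then 0 else c S)) \<omega>"
    unfolding fourier_def by (rule sum.cong) auto
  also have "\<dots> = ?F \<omega> - (p * ?F (fun_upd \<omega> i True) + (1 - p) * ?F (fun_upd \<omega> i False))"
    unfolding fourier_linear fourier_average[OF assms] by simp
  also have "\<dots> = (if \<omega> i then 1 - p else p) * (?F \<omega> - ?F (flip i \<omega>))"
  proof (cases "\<omega> i")
    case True
    then have "fun_upd \<omega> i True = \<omega>" by (auto simp: fun_eq_iff)
    then show ?thesis using True by (simp add: flip_def algebra_simps)
  next
    case False
    then have "fun_upd \<omega> i False = \<omega>" by (auto simp: fun_eq_iff)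
    then show ?thesis using False by (simp add: flip_def algebra_simps)
  qed
  finally show "\<bar>fourier A (\<lambda>S. if i \<in> S then c S else 0) \<omega>\<bar> \<le> \<bar>?F \<omega> - ?F (flip i \<omega>)\<bar>"
    using p0 p1 by (auto simp: abs_mult intro!: mult_left_le_one_le)
qed auto

subsection \<open>The noise operator\<close>

text \<open>A coordinate kept, with probability \<open>1 - \<epsilon>\<close>, contributes its own
  factor \<open>phi\<close>, while a re-sampled one contributes mean zero; so \<open>chi S\<close>
  is an eigenfunction of the noise operator. Each induction step averages over
  \<open>\<eta> j\<close> first and over \<open>r j\<close> second.\<close>

lemma expectation_chi_mix:
  assumes \<epsilon>: "0 \<le> \<epsilon>" "\<epsilon> \<le> 1" and "finite S" "S \<subseteq> {1..n}"
  shows "measure_pmf.expectation (bernoulli_cube n \<epsilon>)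
      (\<lambda>r. E (\<lambda>\<eta>. chi S (\<lambda>i. if r i then \<eta> i else \<omega> i))) = (1 - \<epsilon>) ^ card S * chi S \<omega>"
  using assms(3,4)
proof (induction S rule: finite_induct)
  case empty
  then show ?case by (simp add: chi_def)
next
  case (insert j S)
  let ?m = "\<lambda>r \<eta> i. if r i then \<eta> i else \<omega> i"
  let ?Y = "\<lambda>r. E (\<lambda>\<eta>. chi S (?m r \<eta>))"
  have upd: "chi S (?m (fun_upd r j b) \<eta>) = chi S (?m r \<eta>)"
    "chi S (?m r (fun_upd \<eta> j b)) = chi S (?m r \<eta>)" for r \<eta> b
    using insert.hyps unfolding chi_def by (auto intro!: prod.cong)
  have inner: "E (\<lambda>\<eta>. chi (insert j S) (?m r \<eta>)) = (if r j then 0 else phi (\<omega> j)) * ?Y r" for r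
  proof -
    have avg: "p * (phi (?m r (fun_upd \<eta> j True) j) * x) + (1 - p) * (phi (?m r (fun_upd \<eta> j False) j) * x)
      = (if r j then 0 else phi (\<omega> j)) * x" for \<eta> x
    proof -
      have "p * (phi (?m r (fun_upd \<eta> j True) j) * x) + (1 - p) * (phi (?m r (fun_upd \<eta> j False) j) * x)
        = (if r j then p * phi True + (1 - p) * phi False else phi (\<omega> j)) * x"
        by (simp add: algebra_simps)
      then show ?thesis by (simp add: phi_mean)
    qed
    have "E (\<lambda>\<eta>. chi (insert j S) (?m r \<eta>)) = E (\<lambda>\<eta>. phi (?m r \<eta> j) * chi S (?m r \<eta>))"
      using insert.hyps by (simp add: chi_insert)
    also have "\<dots> = E (\<lambda>\<eta>. (if r j then 0 else phi (\<omega> j)) * chi S (?m r \<eta>))"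
      by (subst expectation_resample[of j]) (use insert.prems p0 p1 in \<open>simp_all only: upd avg, auto\<close>)
    finally show ?thesis by simp
  qed
  have "measure_pmf.expectation (bernoulli_cube n \<epsilon>) (\<lambda>r. E (\<lambda>\<eta>. chi (insert j S) (?m r \<eta>)))
    = measure_pmf.expectation (bernoulli_cube n \<epsilon>) (\<lambda>r. (1 - \<epsilon>) * phi (\<omega> j) * ?Y r)"
    unfolding inner
  proof (subst expectation_resample[of j])
    show "measure_pmf.expectation (bernoulli_cube n \<epsilon>)
        (\<lambda>r. \<epsilon> * ((if fun_upd r j True j then 0 else phi (\<omega> j)) * ?Y (fun_upd r j True))
          + (1 - \<epsilon>) * ((if fun_upd r j False j then 0 else phi (\<omega> j)) * ?Y (fun_upd r j False)))
      = measure_pmf.expectation (bernoulli_cube n \<epsilon>) (\<lambda>r. (1 - \<epsilon>) * phi (\<omega> j) * ?Y r)"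
      by (simp only: upd fun_upd_same if_True if_False mult_zero_left mult_zero_right add_0 mult.assoc)
  qed (use insert.prems \<epsilon> in auto)
  also have "\<dots> = (1 - \<epsilon>) ^ card (insert j S) * chi (insert j S) \<omega>"
    using insert by (simp add: chi_insert)
  finally show ?case .
qed

lemma expectation_noise_pair:
  assumes \<epsilon>: "0 \<le> \<epsilon>" "\<epsilon> \<le> 1" and A: "A \<subseteq> {1..n}"
  shows "measure_pmf.expectation (noise_pair n p \<epsilon>) (\<lambda>(\<omega>, \<omega>'). fourier A c \<omega> * fourier A c \<omega>')
    = (\<Sum>S\<in>Pow A. (1 - \<epsilon>) ^ card S * (c S)\<^sup>2)"
proof -
  let ?m = "\<lambda>\<omega> r \<eta> i. if r i then \<eta> i else \<omega> i"
  let ?F = "fourier A c"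
  have fin: "finite A" using A finite_subset by blast
  have mix: "measure_pmf.expectation (bernoulli_cube n \<epsilon>) (\<lambda>r. E (\<lambda>\<eta>. ?F (?m \<omega> r \<eta>)))
      = fourier A (\<lambda>S. (1 - \<epsilon>) ^ card S * c S) \<omega>" for \<omega>
  proof -
    have "measure_pmf.expectation (bernoulli_cube n \<epsilon>) (\<lambda>r. E (\<lambda>\<eta>. ?F (?m \<omega> r \<eta>)))
      = (\<Sum>S\<in>Pow A. c S * measure_pmf.expectation (bernoulli_cube n \<epsilon>) (\<lambda>r. E (\<lambda>\<eta>. chi S (?m \<omega> r \<eta>))))"
      unfolding fourier_def by simp
    also have "\<dots> = fourier A (\<lambda>S. (1 - \<epsilon>) ^ card S * c S) \<omega>"
      unfolding fourier_def
    proof (rule sum.cong)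
      fix S assume "S \<in> Pow A"
      then have "finite S" "S \<subseteq> {1..n}" using A fin finite_subset by auto
      then show "c S * measure_pmf.expectation (bernoulli_cube n \<epsilon>)
          (\<lambda>r. E (\<lambda>\<eta>. chi S (?m \<omega> r \<eta>))) = (1 - \<epsilon>) ^ card S * c S * chi S \<omega>"
        by (simp add: expectation_chi_mix[OF \<epsilon>])
    qed simp
    finally show ?thesis .
  qed
  have "measure_pmf.expectation (noise_pair n p \<epsilon>) (\<lambda>(\<omega>, \<omega>'). ?F \<omega> * ?F \<omega>')
    = E (\<lambda>\<omega>. measure_pmf.expectation (bernoulli_cube n \<epsilon>) (\<lambda>r. E (\<lambda>\<eta>. ?F \<omega> * ?F (?m \<omega> r \<eta>))))"
    unfolding noise_pair_def by (simp add: expectation_bind_finite)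
  also have "\<dots> = E (\<lambda>\<omega>. ?F \<omega> * fourier A (\<lambda>S. (1 - \<epsilon>) ^ card S * c S) \<omega>)"
    by (simp add: mix)
  also have "\<dots> = (\<Sum>S\<in>Pow A. (1 - \<epsilon>) ^ card S * (c S)\<^sup>2)"
    using fin A by (simp add: parseval power2_eq_square mult_ac)
  finally show ?thesis .
qed

subsection \<open>Spectral weight and influences\<close>

text \<open>The contraction from L^2 to L^4 dualises to one from L^(4/3) to L^2, and the L^(4/3)
  norm is interpolated between L^1 and L^2. The proof does this by testing \<open>u\<close> against
  a single function \<open>v\<close>.\<close>

lemma derivative_weight_le:
  assumes r: "0 \<le> r" "r \<le> 1" "\<And>b. \<bar>r * phi b\<bar> \<le> 1 / 4" and A: "A \<subseteq> {1..n}"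
  shows "(\<Sum>S\<in>Pow A. if i \<in> S then r ^ (4 * card S) * (c S)\<^sup>2 else 0)
    \<le> sqrt (\<Sum>S\<in>Pow A. if i \<in> S then r ^ (2 * card S) * (c S)\<^sup>2 else 0)
      * influence n p i (fourier A c)"
proof -
  define d where "d = (\<lambda>S. if i \<in> S then c S else 0)"
  define u where "u = fourier A (\<lambda>S. r ^ card S * d S)"
  \<comment> \<open>\<open>v\<close> is \<open>T (T u)\<close> for the self-adjoint multiplier
    \<open>T\<close> with factor \<open>r ^ card S\<close>. Hence pairing with \<open>u\<close>
    gives \<open>W\<close>, the squared L^2 norm of \<open>T u\<close>, and hypercontractivity
    bounds the fourth moment of \<open>v\<close> by \<open>W\<^sup>2\<close>.\<close>
  define v where "v = fourier A (\<lambda>S. r ^ card S * (r ^ (2 * card S) * d S))"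
  define W where "W = (\<Sum>S\<in>Pow A. r ^ (4 * card S) * (d S)\<^sup>2)"
  define U where "U = (\<Sum>S\<in>Pow A. r ^ (2 * card S) * (d S)\<^sup>2)"
  have fin: "finite A" using A finite_subset by blast
  have W: "0 \<le> W" and U: "0 \<le> U"
    unfolding W_def U_def using r by (auto intro!: sum_nonneg)
  have "E (\<lambda>\<omega>. \<bar>u \<omega>\<bar>) = E (\<lambda>\<omega>. \<bar>fourier A (\<lambda>S. r ^ card (S \<inter> A) * d S) \<omega>\<bar>)"
  proof -
    have "u = fourier A (\<lambda>S. r ^ card (S \<inter> A) * d S)"
      unfolding u_def fourier_def by (intro ext sum.cong) (auto simp: Int_absorb2)
    then show ?thesis by simp
  qed
  also have "\<dots> \<le> E (\<lambda>\<omega>. \<bar>fourier A d \<omega>\<bar>)"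
    using r fin A by (intro noise_contraction_L1) auto
  also have "\<dots> \<le> influence n p i (fourier A c)"
    unfolding d_def by (rule expectation_derivative_le_influence[OF fin])
  finally have L1: "E (\<lambda>\<omega>. \<bar>u \<omega>\<bar>) \<le> influence n p i (fourier A c)" .
  have L1': "0 \<le> E (\<lambda>\<omega>. \<bar>u \<omega>\<bar>)" by simp
  have pw: "r ^ card S * (r ^ (2 * card S) * d S) * (r ^ card S * d S) = r ^ (4 * card S) * (d S)\<^sup>2"
      "(r ^ card S * d S)\<^sup>2 = r ^ (2 * card S) * (d S)\<^sup>2"
      "(r ^ (2 * card S) * d S)\<^sup>2 = r ^ (4 * card S) * (d S)\<^sup>2" for S
  proof -
    have "r ^ (2 * card S) = (r ^ card S)\<^sup>2" "r ^ (4 * card S) = (r ^ card S) ^ 4"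
      by (simp_all add: mult.commute flip: power_mult)
    then show "r ^ card S * (r ^ (2 * card S) * d S) * (r ^ card S * d S) = r ^ (4 * card S) * (d S)\<^sup>2"
      "(r ^ card S * d S)\<^sup>2 = r ^ (2 * card S) * (d S)\<^sup>2"
      "(r ^ (2 * card S) * d S)\<^sup>2 = r ^ (4 * card S) * (d S)\<^sup>2"
      by (simp_all add: power2_eq_square eval_nat_numeral)
  qed
  have vu: "E (\<lambda>\<omega>. v \<omega> * u \<omega>) = W"
    unfolding v_def u_def W_def parseval[OF fin A] by (simp only: pw)
  have uu: "E (\<lambda>\<omega>. (u \<omega>)\<^sup>2) = U"
    unfolding power2_eq_square[of "u _"] unfolding u_def U_def parseval[OF fin A]
    by (simp only: pw flip: power2_eq_square)
  have v4: "E (\<lambda>\<omega>. (v \<omega>) ^ 4) \<le> W\<^sup>2"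
    using hypercontractive[OF r(3) fin A, of "\<lambda>S. r ^ (2 * card S) * d S"]
    unfolding pw W_def v_def .
  have "W ^ 4 \<le> E (\<lambda>\<omega>. (v \<omega>) ^ 4) * U * (E (\<lambda>\<omega>. \<bar>u \<omega>\<bar>))\<^sup>2"
    using expectation_mult_fourth_le[of n p v u] by (simp only: vu uu)
  also have "\<dots> \<le> W\<^sup>2 * U * (E (\<lambda>\<omega>. \<bar>u \<omega>\<bar>))\<^sup>2"
    by (intro mult_right_mono v4 U) auto
  finally have W4: "W\<^sup>2 * W\<^sup>2 \<le> W\<^sup>2 * (U * (E (\<lambda>\<omega>. \<bar>u \<omega>\<bar>))\<^sup>2)"
    by (simp add: mult.assoc flip: power_add)
  have "W \<le> sqrt U * E (\<lambda>\<omega>. \<bar>u \<omega>\<bar>)"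
  \<comment> \<open>\<open>W\<^sup>2\<close> is cancelled from \<open>W4\<close>, which requires
    \<open>W\<close> to be nonzero.\<close>
  proof (cases "W = 0")
    case True
    then show ?thesis using U by simp
  next
    case False
    then have "0 < W\<^sup>2" by simp
    from mult_left_le_imp_le[OF W4 this] have "W\<^sup>2 \<le> (sqrt U * E (\<lambda>\<omega>. \<bar>u \<omega>\<bar>))\<^sup>2"
      using U by (simp add: power_mult_distrib)
    then show ?thesis by (rule power2_le_imp_le) (use U L1' in simp)
  qed
  also have "\<dots> \<le> sqrt U * influence n p i (fourier A c)"
    using L1 U by (intro mult_left_mono) auto
  finally have "W \<le> sqrt U * influence n p i (fourier A c)" .
  moreover have "r ^ k * (d S)\<^sup>2 = (if i \<in> S then r ^ k * (c S)\<^sup>2 else 0)" for k S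
    by (simp add: d_def)
  ultimately show ?thesis unfolding W_def U_def by simp
qed

lemma damped_weight_le:
  assumes r: "0 \<le> r" "r \<le> 1 / 2" "\<And>b. \<bar>r * phi b\<bar> \<le> 1 / 4"
    and c: "(\<Sum>S\<in>Pow {1..n}. (c S)\<^sup>2) \<le> 1"
  shows "(\<Sum>S\<in>Pow {1..n} - {{}}. r ^ (4 * card S) * (c S)\<^sup>2)
    \<le> sqrt (sum_sq_influences n p (fourier {1..n} c))"
proof -
  let ?A = "{1..n}" and ?I = "\<lambda>i. influence n p i (fourier {1..n} c)"
  define W where "W i = (\<Sum>S\<in>Pow ?A. if i \<in> S then r ^ (4 * card S) * (c S)\<^sup>2 else 0)" for i
  define U where "U i = (\<Sum>S\<in>Pow ?A. if i \<in> S then r ^ (2 * card S) * (c S)\<^sup>2 else 0)" for i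
  have U0: "0 \<le> U i" for i unfolding U_def using r by (auto intro!: sum_nonneg)
  have "(\<Sum>i\<in>?A. U i) = (\<Sum>S\<in>Pow ?A. card S * (r ^ (2 * card S) * (c S)\<^sup>2))"
    unfolding U_def by (rule sum_containing) simp
  also have "\<dots> \<le> (\<Sum>S\<in>Pow ?A. (c S)\<^sup>2)"
  proof (rule sum_mono)
    fix S :: "nat set"
    \<comment> \<open>The damping offsets the level factor:
      \<open>k * r ^ (2 * k) \<le> k / 2 ^ k \<le> 1\<close>.\<close>
    have "r ^ (2 * card S) \<le> (1 / 2) ^ (2 * card S)"
      using r by (intro power_mono) auto
    also have "\<dots> \<le> (1 / 2) ^ card S" by (rule power_decreasing) auto
    finally have "real (card S) * r ^ (2 * card S) \<le> real (card S) * (1 / 2) ^ card S"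
      by (rule mult_left_mono) simp
    also have "\<dots> \<le> 1"
      using of_nat_less_two_power[of "card S", where 'a = real] by (simp add: power_divide)
    finally have "real (card S) * r ^ (2 * card S) * (c S)\<^sup>2 \<le> 1 * (c S)\<^sup>2"
      by (rule mult_right_mono) simp
    then show "card S * (r ^ (2 * card S) * (c S)\<^sup>2) \<le> (c S)\<^sup>2" by (simp add: mult.assoc)
  qed
  finally have U1: "(\<Sum>i\<in>?A. U i) \<le> 1" using c by linarith
  \<comment> \<open>Nonempty sets have \<open>card S \<ge> 1\<close>, so the level factor can be
    inserted to make double counting applicable.\<close>
  have "(\<Sum>S\<in>Pow ?A - {{}}. r ^ (4 * card S) * (c S)\<^sup>2)
    \<le> (\<Sum>S\<in>Pow ?A - {{}}. card S * (r ^ (4 * card S) * (c S)\<^sup>2))"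
  proof (rule sum_mono)
    fix S assume "S \<in> Pow ?A - {{}}"
    then have "card S \<ge> 1" using finite_subset[of S ?A] by (auto simp: Suc_le_eq card_gt_0_iff)
    then have "1 * (r ^ (4 * card S) * (c S)\<^sup>2) \<le> card S * (r ^ (4 * card S) * (c S)\<^sup>2)"
      using r by (intro mult_right_mono) auto
    then show "r ^ (4 * card S) * (c S)\<^sup>2 \<le> card S * (r ^ (4 * card S) * (c S)\<^sup>2)" by simp
  qed
  also have "\<dots> \<le> (\<Sum>S\<in>Pow ?A. card S * (r ^ (4 * card S) * (c S)\<^sup>2))"
    using r by (intro sum_mono2) auto
  also have "\<dots> = (\<Sum>i\<in>?A. W i)"
    unfolding W_def by (rule sum_containing[symmetric]) simp
  also have "\<dots> \<le> (\<Sum>i\<in>?A. sqrt (U i) * ?I i)"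
    unfolding W_def U_def using r by (intro sum_mono derivative_weight_le) auto
  also have "\<dots> \<le> sqrt (sum_sq_influences n p (fourier ?A c))"
  proof (rule real_le_rsqrt)
    \<comment> \<open>Cauchy-Schwarz over coordinates separates the \<open>U i\<close>, whose sum is
      at most 1, from the squared influences.\<close>
    have "(\<Sum>i\<in>?A. sqrt (U i) * ?I i)\<^sup>2 \<le> (\<Sum>i\<in>?A. (sqrt (U i))\<^sup>2) * (\<Sum>i\<in>?A. (?I i)\<^sup>2)"
      by (rule Cauchy_Schwarz_ineq_sum)
    also have "(\<Sum>i\<in>?A. (sqrt (U i))\<^sup>2) = (\<Sum>i\<in>?A. U i)" using U0 by simp
    also have "(\<Sum>i\<in>?A. U i) * (\<Sum>i\<in>?A. (?I i)\<^sup>2) \<le> 1 * (\<Sum>i\<in>?A. (?I i)\<^sup>2)"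
      by (intro mult_right_mono U1 sum_nonneg) auto
    finally show "(\<Sum>i\<in>?A. sqrt (U i) * ?I i)\<^sup>2 \<le> sum_sq_influences n p (fourier ?A c)"
      by (simp add: sum_sq_influences_def)
  qed
  finally show ?thesis .
qed

text \<open>The cutoff \<open>m\<close> is free: levels from \<open>m\<close> on are damped by the
  noise to \<open>(1 - \<epsilon>) ^ m\<close>, and lower levels are compared with the damped weight
  at the cost of the constant \<open>1 / r ^ (4 * m)\<close>.\<close>

lemma noise_covariance_le:
  assumes f: "f \<in> cube n \<rightarrow> {0..1}" and \<epsilon>: "0 \<le> \<epsilon>" "\<epsilon> \<le> 1"
    and r: "0 < r" "r \<le> 1 / 2" "\<And>b. \<bar>r * phi b\<bar> \<le> 1 / 4"
  shows "\<bar>measure_pmf.expectation (noise_pair n p \<epsilon>) (\<lambda>(\<omega>, \<omega>'). f \<omega> * f \<omega>') - (E f)\<^sup>2\<bar>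
    \<le> (1 - \<epsilon>) ^ m + sqrt (sum_sq_influences n p f) / r ^ (4 * m)"
proof -
  let ?A = "{1..n}"
  obtain c where c: "\<And>\<omega>. \<omega> \<in> cube n \<Longrightarrow> f \<omega> = fourier ?A c \<omega>"
    using fourier_expansion[of ?A f] by (auto simp: cube_iff)
  let ?F = "fourier ?A c" and ?w = "\<lambda>S. r ^ (4 * card S) * (c S)\<^sup>2"
  have Ef: "E f = c {}"
  proof -
    have "E f = E ?F" by (rule expectation_cong_cube) (rule c)
    \<comment> \<open>The mean is the inner product with the constant 1, whose coefficients are the
      indicator of the empty set.\<close>
    also have "\<dots> = E (\<lambda>\<omega>. ?F \<omega> * fourier ?A (\<lambda>S. if S = {} then 1 else 0) \<omega>)"
    proof -
      have "fourier ?A (\<lambda>S. if S = {} then 1 else 0) \<omega> = (\<Sum>S\<in>Pow ?A. if S = {} then 1 else 0)" for \<omega>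
        unfolding fourier_def by (intro sum.cong) (auto simp: chi_def)
      then show ?thesis by simp
    qed
    also have "\<dots> = c {}" by (subst parseval) (auto simp: if_distrib cong: if_cong)
    finally show ?thesis .
  qed
  have noise: "measure_pmf.expectation (noise_pair n p \<epsilon>) (\<lambda>(\<omega>, \<omega>'). f \<omega> * f \<omega>')
    = (\<Sum>S\<in>Pow ?A. (1 - \<epsilon>) ^ card S * (c S)\<^sup>2)"
  proof -
    have "measure_pmf.expectation (noise_pair n p \<epsilon>) (\<lambda>(\<omega>, \<omega>'). f \<omega> * f \<omega>')
      = measure_pmf.expectation (noise_pair n p \<epsilon>) (\<lambda>(\<omega>, \<omega>'). ?F \<omega> * ?F \<omega>')"
      using set_noise_pair[of n p \<epsilon>]
      by (intro integral_cong_AE) (auto simp: AE_measure_pmf_iff c)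
    also have "\<dots> = (\<Sum>S\<in>Pow ?A. (1 - \<epsilon>) ^ card S * (c S)\<^sup>2)"
      by (rule expectation_noise_pair[OF \<epsilon>]) simp
    finally show ?thesis .
  qed
  have infl: "sum_sq_influences n p f = sum_sq_influences n p ?F"
  proof -
    \<comment> \<open>\<open>f\<close> agrees with its expansion only on the cube, which flipping a
      coordinate in \<open>{1..n}\<close> preserves.\<close>
    have "influence n p i f = influence n p i ?F" if "i \<in> ?A" for i
      unfolding influence_def
    proof (rule expectation_cong_cube)
      fix \<omega> assume "\<omega> \<in> cube n"
      moreover from this have "flip i \<omega> \<in> cube n" using that by (auto simp: cube_iff flip_def)
      ultimately show "\<bar>f \<omega> - f (flip i \<omega>)\<bar> = \<bar>?F \<omega> - ?F (flip i \<omega>)\<bar>" by (simp add: c)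
    qed
    then show ?thesis by (simp add: sum_sq_influences_def)
  qed
  have c1: "(\<Sum>S\<in>Pow ?A. (c S)\<^sup>2) \<le> 1"
  proof -
    have "(\<Sum>S\<in>Pow ?A. (c S)\<^sup>2) = E (\<lambda>\<omega>. ?F \<omega> * ?F \<omega>)"
      by (subst parseval) (auto simp: power2_eq_square)
    also have "\<dots> = E (\<lambda>\<omega>. f \<omega> * f \<omega>)" by (rule expectation_cong_cube) (simp add: c)
    also have "\<dots> \<le> E (\<lambda>_. 1)"
      using f set_bernoulli_cube[of n p]
      by (intro integral_mono_AE) (auto simp: AE_measure_pmf_iff mult_le_one Pi_iff subset_eq)
    finally show ?thesis by simp
  qed
  have split: "(\<Sum>S\<in>Pow ?A. g S) = g {} + (\<Sum>S\<in>Pow ?A - {{}}. g S)" for g :: "nat set \<Rightarrow> real"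
    by (rule sum.remove) auto
  have c1': "(\<Sum>S\<in>Pow ?A - {{}}. (c S)\<^sup>2) \<le> 1"
    using c1 split[of "\<lambda>S. (c S)\<^sup>2"] by (smt (verit) zero_le_power2)
  have "measure_pmf.expectation (noise_pair n p \<epsilon>) (\<lambda>(\<omega>, \<omega>'). f \<omega> * f \<omega>') - (E f)\<^sup>2
    = (\<Sum>S\<in>Pow ?A - {{}}. (1 - \<epsilon>) ^ card S * (c S)\<^sup>2)"
    unfolding noise Ef split by simp
  moreover have "0 \<le> (\<Sum>S\<in>Pow ?A - {{}}. (1 - \<epsilon>) ^ card S * (c S)\<^sup>2)"
    using \<epsilon> by (intro sum_nonneg) auto
  moreover have "(\<Sum>S\<in>Pow ?A - {{}}. (1 - \<epsilon>) ^ card S * (c S)\<^sup>2)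
    \<le> (1 - \<epsilon>) ^ m + sqrt (sum_sq_influences n p f) / r ^ (4 * m)"
  proof -
    have "(1 - \<epsilon>) ^ card S * (c S)\<^sup>2 \<le> (1 - \<epsilon>) ^ m * (c S)\<^sup>2 + ?w S / r ^ (4 * m)" for S
    proof (cases "m \<le> card S")
      case True
      then have "(1 - \<epsilon>) ^ card S * (c S)\<^sup>2 \<le> (1 - \<epsilon>) ^ m * (c S)\<^sup>2"
        using \<epsilon> by (intro mult_right_mono power_decreasing) auto
      moreover have "0 \<le> ?w S / r ^ (4 * m)" using r by simp
      ultimately show ?thesis by linarith
    next
      case False
      have "(1 - \<epsilon>) ^ card S * (c S)\<^sup>2 \<le> 1 * (c S)\<^sup>2"
        using \<epsilon> by (intro mult_right_mono power_le_one) auto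
      also have "\<dots> \<le> r ^ (4 * card S) / r ^ (4 * m) * (c S)\<^sup>2"
        using False r by (intro mult_right_mono) (auto intro!: power_decreasing)
      finally show ?thesis using \<epsilon> by (simp add: add_increasing)
    qed
    then have "(\<Sum>S\<in>Pow ?A - {{}}. (1 - \<epsilon>) ^ card S * (c S)\<^sup>2)
      \<le> (\<Sum>S\<in>Pow ?A - {{}}. (1 - \<epsilon>) ^ m * (c S)\<^sup>2 + ?w S / r ^ (4 * m))"
      by (rule sum_mono)
    also have "\<dots> = (1 - \<epsilon>) ^ m * (\<Sum>S\<in>Pow ?A - {{}}. (c S)\<^sup>2) + (\<Sum>S\<in>Pow ?A - {{}}. ?w S) / r ^ (4 * m)"
      by (simp add: sum.distrib sum_distrib_left sum_divide_distrib)
    also have "\<dots> \<le> (1 - \<epsilon>) ^ m * 1 + sqrt (sum_sq_influences n p f) / r ^ (4 * m)"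
      unfolding infl using \<epsilon> r c1 c1'
      by (intro add_mono mult_left_mono divide_right_mono damped_weight_le) auto
    finally show ?thesis by simp
  qed
  ultimately show ?thesis by linarith
qed

end

section \<open>Choice of the damping factor and passage to the limit\<close>

theorem theorem1p2:
  fixes f :: "nat \<Rightarrow> (nat \<Rightarrow> bool) \<Rightarrow> real" and p :: real
  assumes f_range: "\<And>n. n \<ge> 1 \<Longrightarrow> f n \<in> cube n \<rightarrow> {0..1}"
    and p: "0 < p" "p < 1"
    and II: "(\<lambda>n. sum_sq_influences n p (f n)) \<longlonglongrightarrow> 0"
  shows "noise_sensitive p f"
  unfolding noise_sensitive_def
proof
  interpret biased_cube n p for n
    using p by unfold_locales
  fix \<epsilon> :: real assume \<epsilon>: "\<epsilon> \<in> {0<..1}"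
  let ?cov = "\<lambda>n. measure_pmf.expectation (noise_pair n p \<epsilon>) (\<lambda>(\<omega>, \<omega>'). f n \<omega> * f n \<omega>')
             - (measure_pmf.expectation (bernoulli_cube n p) (f n))\<^sup>2"
  \<comment> \<open>The two values of \<open>phi\<close> have opposite signs, so their difference
    bounds both absolute values. Thus \<open>r\<close> depends on \<open>p\<close> alone and serves
    every \<open>n\<close>.\<close>
  define K where "K = phi True - phi False"
  have K: "0 < K" "\<bar>phi b\<bar> \<le> K" for b
    using phi_signs by (cases b; simp add: K_def)+
  define r where "r = min (1 / 2) (1 / (4 * K))"
  have r: "0 < r" "r \<le> 1 / 2" using K by (auto simp: r_def)
  have rphi: "\<bar>r * phi b\<bar> \<le> 1 / 4" for b
  proof -
    have "\<bar>r * phi b\<bar> \<le> 1 / (4 * K) * K"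
      unfolding abs_mult using K r by (intro mult_mono) (auto simp: r_def)
    then show ?thesis using K by simp
  qed
  show "?cov \<longlonglongrightarrow> 0"
  proof (rule tendstoI)
    fix e :: real assume e: "e > 0"
    \<comment> \<open>Fixing \<open>m\<close> first makes the high-level term small uniformly in
      \<open>n\<close>; for this fixed \<open>m\<close> the other term vanishes as \<open>n\<close>
      grows.\<close>
    obtain m where m: "(1 - \<epsilon>) ^ m < e"
      using real_arch_pow_inv[of e "1 - \<epsilon>"] e \<epsilon> by auto
    have "(\<lambda>n. (1 - \<epsilon>) ^ m + sqrt (sum_sq_influences n p (f n)) / r ^ (4 * m))
      \<longlonglongrightarrow> (1 - \<epsilon>) ^ m + sqrt 0 / r ^ (4 * m)"
      using r by (intro tendsto_intros II) auto
    then have "\<forall>\<^sub>F n in sequentially. (1 - \<epsilon>) ^ m + sqrt (sum_sq_influences n p (f n)) / r ^ (4 * m) < e"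
      using m by (intro order_tendstoD(2)) auto
    then show "\<forall>\<^sub>F n in sequentially. dist (?cov n) 0 < e"
      using eventually_ge_at_top[of 1]
    proof eventually_elim
      case (elim n)
      have "\<bar>?cov n\<bar> \<le> (1 - \<epsilon>) ^ m + sqrt (sum_sq_influences n p (f n)) / r ^ (4 * m)"
        using \<epsilon> elim by (intro noise_covariance_le f_range r rphi) auto
      with elim show ?case by simp
    qed
  qed
qed

end
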